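(* Let $K\subset\mathbb{R}$ be an open interval and let $\varphi:K\to\mathbb{R}$ be continuous with $0\le\varphi\le\frac{\pi}{2}$. Let $a<b$ be real numbers with $a,\ a+e^{i\varphi}(b-a)\in K$, and let $f:K\to(0,\infty)$ be a twice differentiable mapping such that $f''$ is integrable on $[a,a+e^{i\varphi}(b-a)]$. If $|f''|$ is a log-$\varphi$-convex function on $[a,a+e^{i\varphi}(b-a)]$ and $|f''(a)|\neq|f''(b)|$, then $$\left|\frac{1}{e^{i\varphi}(b-a)}\int_a^{a+e^{i\varphi}(b-a)}f(x)\,dx-\frac{f(a)+f(a+e^{i\varphi}(b-a))}{2}\right|\le\left(\frac{e^{i\varphi}(b-a)}{\log|f''(b)|-\log|f''(a)|}\right)^2\Big[A\big(|f''(b)|,|f''(a)|\big)-L\big(|f''(b)|,|f''(a)|\big)\Big].$$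
   Context: Here $i$ is the imaginary unit. $A(x,y)=\frac{x+y}{2}$ is the arithmetic mean and $L(x,y)=\frac{x-y}{\log x-\log y}$ (for $x,y>0$, $x\ne y$) is the logarithmic mean. In an expression $u+te^{i\varphi}(v-u)$ the argument of $\varphi$ is suppressed and $\varphi$ is read as its value at the base point $u$; thus $a+e^{i\varphi}(b-a)$ uses $\varphi=\varphi(a)$. Since $a+e^{i\varphi}(b-a)$ is an endpoint of a real interval, it is understood to be a real number. A set $S$ is $\varphi$-convex if $u+te^{i\varphi}(v-u)\in S$ for all $u,v\in S$ and $t\in[0,1]$. A function $g$ on a $\varphi$-convex set $S$ with $g>0$ is log-$\varphi$-convex (logarithmic $\varphi$-convex) if $g(u+te^{i\varphi}(v-u))\le g(u)^{1-t}g(v)^t$ for all $u,v\in S$, $t\in[0,1]$. Saying that $g$ is log-$\varphi$-convex on a set includes that the set is $\varphi$-convex and that $g>0$ on it. *)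

theory Defs
  imports "HOL-Analysis.Analysis"
begin

text \<open>
  The exponential \<open>exp (\<i> * \<phi> u)\<close> is complex, so the points reached from real \<open>u\<close>, \<open>v\<close> are
  complex numbers, and the angle is taken at the base point \<open>u\<close>.
\<close>

definition phi_point :: "(real \<Rightarrow> real) \<Rightarrow> real \<Rightarrow> real \<Rightarrow> real \<Rightarrow> complex" where
  "phi_point \<phi> u v t =
     of_real u + of_real t * exp (\<i> * of_real (\<phi> u)) * of_real (v - u)"

text \<open>
  A set of reals is regarded as a subset of the complex plane. Hence \<open>\<phi>\<close>-convexity
  includes the requirement that all the points above are real.
\<close>

definition phi_convex :: "(real \<Rightarrow> real) \<Rightarrow> real set \<Rightarrow> bool" where
  "phi_convex \<phi> S \<longleftrightarrow>
     (\<forall>u\<in>S. \<forall>v\<in>S. \<forall>t\<in>{0..1}. phi_point \<phi> u v t \<in> complex_of_real ` S)"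

text \<open>
  By the first conjunct, \<open>phi_point \<phi> u v t\<close> is the image of an element of \<open>S\<close>; \<open>Re\<close> only
  recovers that element.
\<close>

definition log_phi_convex_on :: "(real \<Rightarrow> real) \<Rightarrow> real set \<Rightarrow> (real \<Rightarrow> real) \<Rightarrow> bool" where
  "log_phi_convex_on \<phi> S g \<longleftrightarrow>
     phi_convex \<phi> S \<and> (\<forall>u\<in>S. g u > 0) \<and>
     (\<forall>u\<in>S. \<forall>v\<in>S. \<forall>t\<in>{0..1}.
        g (Re (phi_point \<phi> u v t)) \<le> g u powr (1 - t) * g v powr t)"

definition arith_mean :: "real \<Rightarrow> real \<Rightarrow> real" where
  "arith_mean x y = (x + y) / 2"

definition log_mean :: "real \<Rightarrow> real \<Rightarrow> real" where
  "log_mean x y = (x - y) / (ln x - ln y)"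

end

theory Submission imports Defs begin

text \<open>
  If \<open>e\<^sup>i\<^sup>\<phi>(b - a)\<close> is real and \<open>0 \<le> \<phi> \<le> \<pi>/2\<close>, then \<open>\<phi>(a) = 0\<close>, so the interval is \<open>[a, b]\<close>
  and only ordinary log-convexity between the endpoints matters. Integrating by parts twice, the error of
  the trapezoidal rule is the integral of \<open>(x - a)(b - x)/2 \<cdot> f''(x)\<close>, and log-convexity bounds
  \<open>\<bar>f''\<bar>\<close> by the exponential interpolating its endpoint values, for which the integral is explicit.
\<close>

text \<open>The imaginary part of the right-hand side is \<open>d * sin \<theta>\<close>, and sine
  is positive on the open interval from 0 to \<open>pi\<close>.\<close>

lemma exp_mult_eq_real_imp_zero:
  fixes \<theta> h d :: real
  assumes "complex_of_real h = exp (\<i> * of_real \<theta>) * of_real d"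
    and "0 \<le> \<theta>" "\<theta> < pi" "d \<noteq> 0"
  shows "\<theta> = 0" "h = d"
proof -
  have "Im (complex_of_real h) = Im (exp (\<i> * of_real \<theta>) * of_real d)"
    using assms(1) by simp
  then have "sin \<theta> = 0"
    using assms(4) by (simp add: Im_exp)
  then show "\<theta> = 0"
    using assms(2,3) sin_gt_zero[of \<theta>] by linarith
  then show "h = d"
    using assms(1) by simp
qed

lemma trapezoid_error_has_integral:
  fixes f f' f'' :: "real \<Rightarrow> real"
  assumes "a \<le> b"
    and f: "\<And>x. x \<in> {a..b} \<Longrightarrow> (f has_real_derivative f' x) (at x)"
    and f': "\<And>x. x \<in> {a..b} \<Longrightarrow> (f' has_real_derivative f'' x) (at x)"
  shows "((\<lambda>x. (x - a) * (b - x) / 2 * f'' x) has_integral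
           (b - a) * (f a + f b) / 2 - integral {a..b} f) {a..b}"
proof -
  \<comment> \<open>With the weight \<open>w = (x - a) * (b - x) / 2\<close> this is
    \<open>w * f' - w' * f\<close>. Since \<open>w'' = -1\<close>, its derivative is
    \<open>w * f'' + f\<close>. As \<open>w\<close> vanishes at both ends, only the terms in
    \<open>f a\<close> and \<open>f b\<close> survive there.\<close>
  define G where "G = (\<lambda>x. (x - a) * (b - x) / 2 * f' x - (a + b - 2 * x) / 2 * f x)"
  have "(G has_real_derivative (x - a) * (b - x) / 2 * f'' x + f x) (at x)" if "x \<in> {a..b}" for x
    unfolding G_def
    by (rule derivative_eq_intros f[OF that] f'[OF that] refl | simp add: field_simps)+
  then have sum: "((\<lambda>x. (x - a) * (b - x) / 2 * f'' x + f x) has_integral G b - G a) {a..b}"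
    using assms(1)
    by (intro fundamental_theorem_of_calculus)
       (auto simp: has_real_derivative_iff_has_vector_derivative[symmetric]
             intro: has_field_derivative_at_within)
  have int_f: "(f has_integral integral {a..b} f) {a..b}"
    using DERIV_isCont[OF f]
    by (intro integrable_integral integrable_continuous_real continuous_at_imp_continuous_on) blast
  have diff_G: "G b - G a = (b - a) * (f a + f b) / 2"
    by (simp add: G_def field_simps)
  show ?thesis
    using has_integral_diff[OF sum int_f] unfolding diff_G add_diff_cancel_right' .
qed

lemma parabola_mult_exp_has_integral:
  fixes a b k :: real
  assumes "a \<le> b" "k \<noteq> 0"
  shows "((\<lambda>x. (x - a) * (b - x) / 2 * exp (k * (x - a))) has_integral
           (b - a) * (1 + exp (k * (b - a))) / (2 * k\<^sup>2) - (exp (k * (b - a)) - 1) / k ^ 3) {a..b}"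
proof -
  \<comment> \<open>Repeated integration by parts against the exponential gives the factor
    \<open>w / k - w' / k\<^sup>2 + w'' / k ^ 3\<close>, where \<open>w\<close> is the quadratic
    weight and \<open>w'' = -1\<close>; the series stops because \<open>w''' = 0\<close>.\<close>
  define H where "H = (\<lambda>x. exp (k * (x - a)) *
    ((x - a) * (b - x) / 2 / k - (a + b - 2 * x) / 2 / k\<^sup>2 - 1 / k ^ 3))"
  have "(H has_real_derivative (x - a) * (b - x) / 2 * exp (k * (x - a))) (at x)" for x
    unfolding H_def using assms(2)
    by (auto intro!: derivative_eq_intros simp: divide_simps power2_eq_square power3_eq_cube)
       (simp add: algebra_simps)
  then have "((\<lambda>x. (x - a) * (b - x) / 2 * exp (k * (x - a))) has_integral H b - H a) {a..b}"
    using assms(1)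
    by (intro fundamental_theorem_of_calculus)
       (auto simp: has_real_derivative_iff_has_vector_derivative[symmetric]
             intro: has_field_derivative_at_within)
  moreover have "H b - H a =
      (b - a) * (1 + exp (k * (b - a))) / (2 * k\<^sup>2) - (exp (k * (b - a)) - 1) / k ^ 3"
    using assms(2) by (simp add: H_def divide_simps power2_eq_square power3_eq_cube)
      (simp add: algebra_simps)
  ultimately show ?thesis
    by simp
qed

theorem theorem8:
  fixes K :: "real set" and \<phi> f f' f'' :: "real \<Rightarrow> real" and a b h :: real
  assumes "open K" and "is_interval K"
    and "continuous_on K \<phi>"
    and "\<And>x. x \<in> K \<Longrightarrow> 0 \<le> \<phi> x \<and> \<phi> x \<le> pi / 2"
    and "a < b"
    and "complex_of_real h = exp (\<i> * of_real (\<phi> a)) * of_real (b - a)"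
    and "a \<in> K" and "a + h \<in> K"
    and "\<And>x. x \<in> K \<Longrightarrow> f x > 0"
    and "\<And>x. x \<in> K \<Longrightarrow> (f has_real_derivative f' x) (at x)"
    and "\<And>x. x \<in> K \<Longrightarrow> (f' has_real_derivative f'' x) (at x)"
    and "f'' absolutely_integrable_on {a..a + h}"
    and "log_phi_convex_on \<phi> {a..a + h} (\<lambda>x. \<bar>f'' x\<bar>)"
    and "\<bar>f'' a\<bar> \<noteq> \<bar>f'' b\<bar>"
  shows "\<bar>1 / h * integral {a..a + h} f - (f a + f (a + h)) / 2\<bar>
    \<le> (h / (ln \<bar>f'' b\<bar> - ln \<bar>f'' a\<bar>))\<^sup>2
        * (arith_mean \<bar>f'' b\<bar> \<bar>f'' a\<bar> - log_mean \<bar>f'' b\<bar> \<bar>f'' a\<bar>)"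
proof -
  \<comment> \<open>This excludes the angle \<open>pi\<close>, where the exponential is real too,
    but equal to -1.\<close>
  have "\<phi> a < pi"
    using assms(4)[OF assms(7)] pi_gt_zero by linarith
  then have \<phi>0: "\<phi> a = 0" and h: "h = b - a"
    using exp_mult_eq_real_imp_zero[OF assms(6)] assms(4)[OF assms(7)] assms(5) by auto
  have ab: "a + h = b" and "h > 0"
    using h assms(5) by auto
  have sub: "{a..b} \<subseteq> K"
    using assms(2,7,8) ab by (meson atLeastAtMost_iff mem_is_interval_1_I subsetI)
  define A where "A = \<bar>f'' a\<bar>"
  define B where "B = \<bar>f'' b\<bar>"
  have lc: "log_phi_convex_on \<phi> {a..b} (\<lambda>x. \<bar>f'' x\<bar>)"
    using assms(13) ab by simp
  have "A > 0" "B > 0"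
    using lc assms(5) unfolding log_phi_convex_on_def A_def B_def by auto
  have "ln B \<noteq> ln A"
    using assms(14) \<open>A > 0\<close> \<open>B > 0\<close> by (auto simp: A_def B_def)
  \<comment> \<open>The slope of the chord of \<open>ln \<bar>f''\<bar>\<close> over the interval,
    so that \<open>A * exp (k * (x - a))\<close> equals \<open>A\<close> at \<open>a\<close> and
    \<open>B\<close> at \<open>b\<close>. It is nonzero because the endpoint values differ.\<close>
  define k where "k = (ln B - ln A) / h"
  have "k \<noteq> 0" and kh: "k * h = ln B - ln A"
    using \<open>ln B \<noteq> ln A\<close> \<open>h > 0\<close> by (auto simp: k_def)
  have expkh: "A * exp (k * h) = B"
    using \<open>A > 0\<close> \<open>B > 0\<close> by (simp add: kh exp_diff)
  have bound: "\<bar>f'' x\<bar> \<le> A * exp (k * (x - a))" if x: "x \<in> {a..b}" for x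
  proof -
    \<comment> \<open>Log-convexity is applied with base point \<open>a\<close>, where the angle is
      known to be 0; this \<open>t\<close> makes the resulting point equal to
      \<open>x\<close>.\<close>
    define t where "t = (x - a) / h"
    have t: "t \<in> {0..1}" and xt: "x = a + t * (b - a)"
      using x \<open>h > 0\<close> by (auto simp: t_def h divide_simps)
    have "phi_point \<phi> a b t = of_real x"
      by (simp add: phi_point_def \<phi>0 xt)
    moreover have "\<bar>f'' (Re (phi_point \<phi> a b t))\<bar> \<le> A powr (1 - t) * B powr t"
      using lc assms(5) t unfolding log_phi_convex_on_def A_def B_def by auto
    moreover have "A powr (1 - t) * B powr t = A * exp (t * (ln B - ln A))"
      using \<open>A > 0\<close> \<open>B > 0\<close> by (simp add: powr_def algebra_simps exp_add exp_diff)
    moreover have "t * (ln B - ln A) = k * (x - a)"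
      by (simp add: t_def k_def)
    ultimately show ?thesis
      by simp
  qed
  define E where "E = h * (f a + f b) / 2 - integral {a..b} f"
  have E: "((\<lambda>x. (x - a) * (b - x) / 2 * f'' x) has_integral E) {a..b}"
    unfolding E_def h using assms(5) sub assms(10,11)
    by (intro trapezoid_error_has_integral[where f' = f']) auto
  \<comment> \<open>The integral of the weight times the exponential majorant of
    \<open>\<bar>f''\<bar>\<close>. The weight is nonnegative on the interval, so \<open>M\<close>
    will bound \<open>\<bar>E\<bar>\<close>.\<close>
  define M where "M = A * (h * (1 + exp (k * h)) / (2 * k\<^sup>2) - (exp (k * h) - 1) / k ^ 3)"
  have M: "((\<lambda>x. A * ((x - a) * (b - x) / 2 * exp (k * (x - a)))) has_integral M) {a..b}"
    unfolding M_def h using assms(5) \<open>k \<noteq> 0\<close>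
    by (intro has_integral_mult_right parabola_mult_exp_has_integral) auto
  have "norm ((x - a) * (b - x) / 2 * f'' x) \<le> A * ((x - a) * (b - x) / 2 * exp (k * (x - a)))"
    if "x \<in> {a..b}" for x
  proof -
    have w: "0 \<le> (x - a) * (b - x) / 2"
      using that by simp
    then have "norm ((x - a) * (b - x) / 2 * f'' x) = (x - a) * (b - x) / 2 * \<bar>f'' x\<bar>"
      by (simp only: real_norm_def abs_mult[of _ "f'' x"] abs_of_nonneg)
    also have "\<dots> \<le> (x - a) * (b - x) / 2 * (A * exp (k * (x - a)))"
      using mult_left_mono[OF bound[OF that] w] .
    also have "\<dots> = A * ((x - a) * (b - x) / 2 * exp (k * (x - a)))"
      by (rule mult.left_commute)
    finally show ?thesis .
  qed
  then have "\<bar>E\<bar> \<le> M"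
    using integral_norm_bound_integral[OF has_integral_integrable[OF E] has_integral_integrable[OF M],
        unfolded integral_unique[OF E] integral_unique[OF M] real_norm_def]
    by simp
  have "1 / h * integral {a..a + h} f - (f a + f (a + h)) / 2 = - (E / h)"
    using \<open>h > 0\<close> unfolding ab E_def by (simp add: field_simps)
  then have "\<bar>1 / h * integral {a..a + h} f - (f a + f (a + h)) / 2\<bar> = \<bar>E / h\<bar>"
    by simp
  also have "\<dots> \<le> M / h"
    using \<open>\<bar>E\<bar> \<le> M\<close> \<open>h > 0\<close> by (simp add: abs_divide divide_right_mono)
  \<comment> \<open>Distributing \<open>A\<close> makes each exponential appear as
    \<open>A * exp (k * h)\<close>, which is \<open>B\<close>. After division by \<open>h\<close>,
    the factor \<open>1 / k\<^sup>2\<close> comes out, and \<open>k * h = ln B - ln A\<close> turns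
    \<open>(B - A) / (k * h)\<close> into the logarithmic mean.\<close>
  also have "M = h * (A + A * exp (k * h)) / (2 * k\<^sup>2) - (A * exp (k * h) - A) / k ^ 3"
    by (simp add: M_def algebra_simps add_divide_distrib diff_divide_distrib)
  also have "\<dots> / h = (1 / k)\<^sup>2 * ((B + A) / 2 - (B - A) / (k * h))"
    unfolding expkh using \<open>k \<noteq> 0\<close> \<open>h > 0\<close>
    by (simp add: divide_simps power2_eq_square power3_eq_cube)
  also have "1 / k = h / (ln B - ln A)"
    by (simp add: k_def)
  finally show ?thesis
    by (simp add: kh arith_mean_def log_mean_def A_def B_def)
qed

end
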